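(* For every integer $n\geq 1$ there is a bijection $\Psi:\mathcal{DU}_n\to\mathcal{BT}_n$ such that for every $\pi\in\mathcal{DU}_n$, the first letter $\pi_1$ of $\pi$ equals $\textsc{Leaf}(\Psi(\pi))$, the leaf at the end of the minimal path of the tree $\Psi(\pi)$.
   Context: $[n]=\{1,\dots,n\}$. $\mathcal{DU}_n$ is the set of down-up permutations of $[n]$, i.e. permutations $\pi=\pi_1\pi_2\cdots\pi_n$ with $\pi_1>\pi_2<\pi_3>\pi_4<\cdots$. An increasing tree on $[n]$ is a tree with vertex set $[n]$, rooted at $1$, in which labels increase along every path going away from the root; for an edge $\{i,j\}$ with $i<j$, $i$ is the parent of $j$ and $j$ a child of $i$. Children are unordered. $\mathcal{BT}_n$ is the set of increasing trees on $[n]$ in which every vertex has at most two children. The minimal path of $T\in\mathcal{BT}_n$ is the sequence $a_1,\dots,a_\ell$ with $a_1=1$, $a_i$ the smallest child of $a_{i-1}$ for $i\ge 2$, and $a_\ell$ a leaf (a vertex with no child); $\textsc{Leaf}(T)=a_\ell$. *)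

theory Defs
  imports "HOL-Combinatorics.Permutations"
begin

text \<open>The word \<open>\<pi>\<^sub>1 \<dots> \<pi>\<^sub>n\<close> is the function \<open>p\<close> with \<open>p i = \<pi>\<^sub>i\<close>, extended by the identity outside
  \<open>{1..n}\<close>.\<close>

definition down_up :: "nat \<Rightarrow> (nat \<Rightarrow> nat) set" where
  "down_up n = {p. p permutes {1..n} \<and>
     (\<forall>i\<in>{1..<n}. if odd i then p i > p (Suc i) else p i < p (Suc i))}"

text \<open>A graph on a given vertex set \<open>V\<close> is represented by its set \<open>E\<close> of edges, each a
  two-element set of vertices. The predicate \<open>tree\<close> of the AFP entry Graph_Theory is not
  suitable here: it only excludes directed cycles.\<close>

definition graph_path :: "'a set \<Rightarrow> 'a set set \<Rightarrow> 'a list \<Rightarrow> bool" where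
  "graph_path V E p \<longleftrightarrow>
     p \<noteq> [] \<and> set p \<subseteq> V \<and> distinct p \<and> successively (\<lambda>u v. {u, v} \<in> E) p"

definition graph_cycle :: "'a set \<Rightarrow> 'a set set \<Rightarrow> 'a list \<Rightarrow> bool" where
  "graph_cycle V E p \<longleftrightarrow> graph_path V E p \<and> length p \<ge> 3 \<and> {last p, hd p} \<in> E"

definition is_tree :: "'a set \<Rightarrow> 'a set set \<Rightarrow> bool" where
  "is_tree V E \<longleftrightarrow>
     V \<noteq> {} \<and>
     E \<subseteq> {{u, v} |u v. u \<in> V \<and> v \<in> V \<and> u \<noteq> v} \<and>
     (\<forall>u\<in>V. \<forall>v\<in>V. \<exists>p. graph_path V E p \<and> hd p = u \<and> last p = v) \<and>
     (\<nexists>p. graph_cycle V E p)"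

definition increasing_tree :: "nat \<Rightarrow> nat set set \<Rightarrow> bool" where
  "increasing_tree n E \<longleftrightarrow>
     is_tree {1..n} E \<and>
     (\<forall>p. graph_path {1..n} E p \<and> hd p = 1 \<longrightarrow> sorted_wrt (<) p)"

definition children :: "nat set set \<Rightarrow> nat \<Rightarrow> nat set" where
  "children E i = {j. {i, j} \<in> E \<and> i < j}"

definition binary_trees :: "nat \<Rightarrow> nat set set set" where
  "binary_trees n = {E. increasing_tree n E \<and> (\<forall>v\<in>{1..n}. card (children E v) \<le> 2)}"

definition minimal_path :: "nat set set \<Rightarrow> nat list \<Rightarrow> bool" where
  "minimal_path E a \<longleftrightarrow>
     a \<noteq> [] \<and> hd a = 1 \<and>
     successively (\<lambda>x y. children E x \<noteq> {} \<and> y = Min (children E x)) a \<and>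
     children E (last a) = {}"

definition Leaf :: "nat set set \<Rightarrow> nat" where
  "Leaf E = last (THE a. minimal_path E a)"

text \<open>The description in \<open>Leaf\<close> is proper:\<close>

lemma ex1_minimal_path:
  assumes "E \<in> binary_trees n"
  shows "\<exists>!a. minimal_path E a"
proof -
  let ?R = "\<lambda>x y. children E x \<noteq> {} \<and> y = Min (children E x)"
  have E: "E \<subseteq> {{u, v} |u v. u \<in> {1..n} \<and> v \<in> {1..n} \<and> u \<noteq> v}"
    using assms by (simp add: binary_trees_def increasing_tree_def is_tree_def)
  have ch: "children E v \<subseteq> {v<..n}" for v
  proof
    fix j assume "j \<in> children E v"
    then have "{v, j} \<in> E" "v < j" by (auto simp: children_def)
    then obtain x y where "{v, j} = {x, y}" "x \<in> {1..n}" "y \<in> {1..n}"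
      using E by blast
    then show "j \<in> {v<..n}" using \<open>v < j\<close> by (auto simp: doubleton_eq_iff)
  qed
  have fin: "finite (children E v)" for v
    using ch[of v] finite_subset by blast
  have ex: "\<exists>a. a \<noteq> [] \<and> hd a = v \<and> successively ?R a \<and> children E (last a) = {}" for v
  proof (induction "n - v" arbitrary: v rule: less_induct)
    case less
    show ?case
    proof (cases "children E v = {}")
      case True
      then show ?thesis by (intro exI[of _ "[v]"]) simp
    next
      case False
      let ?m = "Min (children E v)"
      have "?m \<in> {v<..n}" using Min_in[OF fin False] ch by blast
      then have "n - ?m < n - v" by auto
      from less[OF this] obtain a where
        "a \<noteq> []" "hd a = ?m" "successively ?R a" "children E (last a) = {}" by blast
      then show ?thesis using False
        by (intro exI[of _ "v # a"]) (auto simp: successively_Cons)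
    qed
  qed
  have uniq: "a = b"
    if "a \<noteq> []" "b \<noteq> []" "hd a = hd b" "successively ?R a" "successively ?R b"
      "children E (last a) = {}" "children E (last b) = {}" for a b
    using that
  proof (induction a arbitrary: b)
    case Nil
    then show ?case by simp
  next
    case (Cons x xs)
    then obtain ys where b: "b = x # ys" by (cases b) auto
    show ?case
    proof (cases "xs = [] \<or> ys = []")
      case True
      then show ?thesis using Cons.prems b
        by (auto simp: successively_Cons split: if_splits)
    next
      case False
      then have "xs = ys" using Cons.prems b
        by (intro Cons.IH) (auto simp: successively_Cons)
      then show ?thesis using b by simp
    qed
  qed
  show ?thesis
    using ex[of 1] uniq unfolding minimal_path_def by (intro ex_ex1I) auto
qed

end

theory Submission
  imports Defs
begin

text \<open>For a finite set \<open>S\<close> of labels let \<open>N(S,k)\<close> be the number of down-up words on \<open>S\<close> with first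
  letter \<open>k\<close>, or the number of binary increasing trees on \<open>S\<close> whose minimal path ends in \<open>k\<close>. Both
  satisfy, for consecutive elements \<open>b < c\<close> of \<open>S \<noteq> {b,c}\<close>,
  \<open>N(S,c) = N(S,b) + (\<Sum>p>c. N(S - {b,c},p))\<close>, so they agree, and bijections between the fibres can
  be glued.

  Exchanging \<open>b\<close> and \<open>c\<close> matches most objects counted by \<open>N(S,c)\<close> and \<open>N(S,b)\<close>. For words, the
  unmatched ones begin with \<open>c b\<close>. For trees, the unmatched ones are on one side those where the leaf
  \<open>c\<close> is a child of \<open>b\<close>, and on the other those where the leaf \<open>b\<close> is a sibling of \<open>c\<close>; a local
  surgery around \<open>b\<close> identifies the former with the latter together with the trees on \<open>S - {b,c}\<close>
  whose minimal path ends above \<open>c\<close>.\<close>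

section \<open>Increasing trees as terms\<close>

text \<open>Of two children the smaller one is the left one (see \<open>valid\<close> below), so unordered trees have unique
  representations and the minimal path is the left spine.\<close>

datatype inctree = Tip (root: nat) | Unary (root: nat) inctree | Binary (root: nat) inctree inctree

fun labels :: "inctree \<Rightarrow> nat set" where
  "labels (Tip a) = {a}"
| "labels (Unary a t) = insert a (labels t)"
| "labels (Binary a l r) = insert a (labels l \<union> labels r)"

fun relabel :: "(nat \<Rightarrow> nat) \<Rightarrow> inctree \<Rightarrow> inctree" where
  "relabel f (Tip a) = Tip (f a)"
| "relabel f (Unary a t) = Unary (f a) (relabel f t)"
| "relabel f (Binary a l r) = Binary (f a) (relabel f l) (relabel f r)"

fun valid :: "inctree \<Rightarrow> bool" where
  "valid (Tip a) \<longleftrightarrow> True"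
| "valid (Unary a t) \<longleftrightarrow> a < root t \<and> valid t"
| "valid (Binary a l r) \<longleftrightarrow> a < root l \<and> root l < root r \<and> valid l \<and> valid r \<and> labels l \<inter> labels r = {}"

fun leaf :: "inctree \<Rightarrow> nat" where
  "leaf (Tip a) = a"
| "leaf (Unary a t) = leaf t"
| "leaf (Binary a l r) = leaf l"

definition inctrees :: "nat set \<Rightarrow> inctree set" where
  "inctrees S = {t. valid t \<and> labels t = S}"

lemma root_in_labels [simp]: "root t \<in> labels t"
  by (cases t) auto

lemma leaf_in_labels [simp]: "leaf t \<in> labels t"
  by (induction t) auto

lemma root_le: "valid t \<Longrightarrow> x \<in> labels t \<Longrightarrow> root t \<le> x"
  by (induction t) force+

lemma less_root_notin: "x < root t \<Longrightarrow> valid t \<Longrightarrow> x \<notin> labels t"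
  using root_le[of t x] by auto

lemma root_le_leaf: "valid t \<Longrightarrow> root t \<le> leaf t"
  by (simp add: root_le)

text \<open>Labels increase strictly along the left spine, so equal ends leave a spine of one
  vertex.\<close>

lemma root_eq_leaf: "valid t \<Longrightarrow> root t = leaf t \<Longrightarrow> t = Tip (leaf t)"
  using root_le_leaf by (cases t) force+

lemma finite_labels [simp]: "finite (labels t)"
  by (induction t) auto

lemma labels_relabel [simp]: "labels (relabel f t) = f ` labels t"
  by (induction t) auto

lemma root_relabel [simp]: "root (relabel f t) = f (root t)"
  by (cases t) auto

lemma leaf_relabel [simp]: "leaf (relabel f t) = f (leaf t)"
  by (induction t) auto

lemma relabel_id: "(\<And>x. x \<in> labels t \<Longrightarrow> f (g x) = x) \<Longrightarrow> relabel f (relabel g t) = t"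
  by (induction t) auto

lemma valid_relabel:
  "strict_mono_on (labels t) f \<Longrightarrow> valid t \<Longrightarrow> valid (relabel f t)"
proof (induction t)
  case (Unary a t)
  then show ?case
    by (auto simp: strict_mono_on_def)
next
  case (Binary a l r)
  have "inj_on f (labels l \<union> labels r)"
    by (rule inj_on_subset[OF strict_mono_on_imp_inj_on[OF Binary.prems(1)]]) auto
  then have "f ` labels l \<inter> f ` labels r = {}"
    using Binary.prems(2) by (force dest: inj_onD)
  moreover have "strict_mono_on (labels l) f" "strict_mono_on (labels r) f"
    using Binary.prems(1) by (auto simp: strict_mono_on_def)
  ultimately show ?case
    using Binary by (auto simp: strict_mono_on_def)
qed auto

section \<open>Exchanging two consecutive labels\<close>

locale label_pair =
  fixes b c :: nat
  assumes bc: "b < c"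
begin

fun leaf_child :: "inctree \<Rightarrow> bool" where
  "leaf_child (Tip a) \<longleftrightarrow> False"
| "leaf_child (Unary a t) \<longleftrightarrow> a = b \<and> t = Tip c \<or> leaf_child t"
| "leaf_child (Binary a l r) \<longleftrightarrow> a = b \<and> l = Tip c \<or> leaf_child l"

text \<open>Only the leaf \<open>b\<close> has to be childless; the sibling \<open>c\<close> may
  carry a subtree, since just \<open>root r\<close> is prescribed.\<close>

fun leaf_sibling :: "inctree \<Rightarrow> bool" where
  "leaf_sibling (Tip a) \<longleftrightarrow> False"
| "leaf_sibling (Unary a t) \<longleftrightarrow> leaf_sibling t"
| "leaf_sibling (Binary a l r) \<longleftrightarrow> l = Tip b \<and> root r = c \<or> leaf_sibling l"

lemma transpose_mono:
  assumes "\<forall>z\<in>S. z \<le> b \<or> c \<le> z" "x \<in> S" "y \<in> S" "x < y" "x \<noteq> b \<or> y \<noteq> c"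
  shows "transpose b c x < transpose b c y"
proof -
  have "x \<le> b \<or> c \<le> x" "y \<le> b \<or> c \<le> y"
    using assms by auto
  then show ?thesis
    using assms(4,5) bc unfolding transpose_def by auto
qed

lemma transpose_strict_mono_on:
  assumes "\<forall>z\<in>S. z \<le> b \<or> c \<le> z" "b \<notin> S \<or> c \<notin> S"
  shows "strict_mono_on S (transpose b c)"
  unfolding strict_mono_on_def using assms transpose_mono[of S] by blast

text \<open>Validity compares a vertex with its child and two siblings with each other, and the
  exchange reverses only the pair \<open>b\<close>, \<open>c\<close>. If \<open>b\<close> is the
  parent or the left sibling of \<open>c\<close> at the left spine, the leaf must be
  \<open>c\<close> or \<open>b\<close> respectively, which is one of the excluded configurations. A
  right subtree lacks the leaf, so it holds at most one of the two labels.\<close>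

lemma valid_relabel_transpose:
  assumes "valid t" "\<forall>z\<in>labels t. z \<le> b \<or> c \<le> z" "leaf t \<in> {b, c}"
    "\<not> leaf_child t" "\<not> leaf_sibling t"
  shows "valid (relabel (transpose b c) t)"
  using assms
proof (induction t)
  case (Unary a t)
  have "\<not> (a = b \<and> root t = c)"
  proof
    assume *: "a = b \<and> root t = c"
    then have "leaf t = c"
      using Unary.prems root_le_leaf[of t] by auto
    with * root_eq_leaf[of t] Unary.prems show False by auto
  qed
  then show ?case
    using Unary transpose_mono[of "labels (Unary a t)" a "root t"] by auto
next
  case (Binary a l r)
  have leafl: "leaf l \<in> {b, c}" "leaf l \<notin> labels r"
    using Binary.prems by (auto simp: disjoint_iff)
  have root_leaf: "l = Tip (leaf l)" if "root l = leaf l"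
    using that Binary.prems(1) root_eq_leaf by auto
  have 1: "\<not> (a = b \<and> root l = c)"
  proof
    assume *: "a = b \<and> root l = c"
    then have "leaf l = c"
      using Binary.prems root_le_leaf[of l] by auto
    with * root_leaf Binary.prems show False by auto
  qed
  have 2: "\<not> (root l = b \<and> root r = c)"
  proof
    assume *: "root l = b \<and> root r = c"
    then have "leaf l = b"
      using leafl by (metis insertE root_in_labels singletonD)
    with * root_leaf Binary.prems show False by auto
  qed
  have "strict_mono_on (labels r) (transpose b c)"
    using transpose_strict_mono_on[of "labels r"] leafl Binary.prems by auto
  then have "valid (relabel (transpose b c) r)"
    using Binary.prems by (intro valid_relabel) auto
  moreover have "valid (relabel (transpose b c) l)"
    using Binary leafl by auto
  moreover have "transpose b c ` labels l \<inter> transpose b c ` labels r = {}"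
    using Binary.prems by (simp flip: image_Int)
  ultimately show ?case
    using Binary.prems 1 2 transpose_mono[of "labels (Binary a l r)" a "root l"]
      transpose_mono[of "labels (Binary a l r)" "root l" "root r"] by auto
qed auto

text \<open>A leaf \<open>c\<close> below \<open>b\<close> after the exchange was a leaf
  \<open>b\<close> below \<open>c\<close> before it. Hence the exchange never leads from a valid
  tree into the excluded configuration.\<close>

lemma leaf_child_relabel:
  "leaf_child (relabel (transpose b c) t) \<Longrightarrow> \<not> valid t"
proof (induction t)
  case (Unary a t)
  then show ?case using bc by (cases t) (auto simp: transpose_eq_iff)
next
  case (Binary a l r)
  then show ?case using bc by (cases l) (auto simp: transpose_eq_iff)
qed auto

lemma leaf_sibling_relabel:
  "leaf_sibling (relabel (transpose b c) t) \<Longrightarrow> \<not> valid t"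
proof (induction t)
  case (Binary a l r)
  then show ?case using bc by (cases l) (auto simp: transpose_eq_iff)
qed auto

lemma leaf_child_leaf: "leaf_child t \<Longrightarrow> leaf t = c"
  by (induction t) auto

lemma leaf_sibling_leaf: "leaf_sibling t \<Longrightarrow> leaf t = b"
  by (induction t) auto

text \<open>The exchange is its own inverse. On either side the value of the leaf rules out one of
  the two obstructions, and the filter rules out the other.\<close>

lemma card_transpose_trees:
  assumes "b \<in> S" "c \<in> S" "\<forall>z\<in>S. z \<le> b \<or> c \<le> z"
  shows "card {t \<in> inctrees S. leaf t = c \<and> \<not> leaf_child t} =
    card {t \<in> inctrees S. leaf t = b \<and> \<not> leaf_sibling t}"
proof (rule bij_betw_same_card)
  let ?f = "relabel (transpose b c)"
  have img: "transpose b c ` S = S"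
    using assms by (simp add: transpose_image_eq)
  show "bij_betw ?f {t \<in> inctrees S. leaf t = c \<and> \<not> leaf_child t}
     {t \<in> inctrees S. leaf t = b \<and> \<not> leaf_sibling t}"
  proof (rule bij_betw_byWitness[where f' = ?f])
    show "?f ` {t \<in> inctrees S. leaf t = c \<and> \<not> leaf_child t}
      \<subseteq> {t \<in> inctrees S. leaf t = b \<and> \<not> leaf_sibling t}"
    proof (rule image_subsetI)
      fix t assume t: "t \<in> {t \<in> inctrees S. leaf t = c \<and> \<not> leaf_child t}"
      then have "\<not> leaf_sibling t"
        using bc leaf_sibling_leaf by auto
      with t have "valid (relabel (transpose b c) t)"
        using assms(3) by (intro valid_relabel_transpose) (auto simp: inctrees_def)
      with t show "?f t \<in> {t \<in> inctrees S. leaf t = b \<and> \<not> leaf_sibling t}"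
        using leaf_sibling_relabel img by (auto simp: inctrees_def)
    qed
    show "?f ` {t \<in> inctrees S. leaf t = b \<and> \<not> leaf_sibling t}
      \<subseteq> {t \<in> inctrees S. leaf t = c \<and> \<not> leaf_child t}"
    proof (rule image_subsetI)
      fix t assume t: "t \<in> {t \<in> inctrees S. leaf t = b \<and> \<not> leaf_sibling t}"
      then have "\<not> leaf_child t"
        using bc leaf_child_leaf by auto
      with t have "valid (relabel (transpose b c) t)"
        using assms(3) by (intro valid_relabel_transpose) (auto simp: inctrees_def)
      with t show "?f t \<in> {t \<in> inctrees S. leaf t = c \<and> \<not> leaf_child t}"
        using leaf_child_relabel img by (auto simp: inctrees_def)
    qed
  qed (auto intro: relabel_id)
qed

text \<open>If \<open>b\<close> has children \<open>c, g\<close> and sibling \<open>f\<close>, the comparison of \<open>f\<close> and \<open>g\<close> carries one bit: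
  for \<open>f < g\<close> both become children of \<open>c\<close>, which is made the sibling of \<open>b\<close>, and for \<open>g < f\<close> both
  become children of the parent of \<open>b\<close>. On trees that do not satisfy \<open>leaf_child\<close>, and on
  \<open>Unary b (Tip c)\<close>, the value is irrelevant.\<close>

fun detach :: "inctree \<Rightarrow> inctree + inctree" where
  "detach (Tip a) = Inl (Tip a)"
| "detach (Unary a t) = (if a = b then Inl (Unary a t) else
     case t of
       Unary x s \<Rightarrow> if x = b then Inl (Binary a (Tip b) (Tip c)) else map_sum (Unary a) (Unary a) (detach t)
     | Binary x s g \<Rightarrow> if x = b then Inl (Binary a (Tip b) (Unary c g)) else map_sum (Unary a) (Unary a) (detach t)
     | Tip x \<Rightarrow> Inl (Tip a))"
| "detach (Binary a l r) = (if a = b then Inr r else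
     case l of
       Unary x s \<Rightarrow> if x = b then Inr (Unary a r) else map_sum (\<lambda>l. Binary a l r) (\<lambda>l. Binary a l r) (detach l)
     | Binary x s g \<Rightarrow> if x = b then
          (if root r < root g then Inl (Binary a (Tip b) (Binary c r g)) else Inr (Binary a g r))
          else map_sum (\<lambda>l. Binary a l r) (\<lambda>l. Binary a l r) (detach l)
     | Tip x \<Rightarrow> Inl (Tip a))"

text \<open>Undoes the \<open>Inl\<close> results. The number of children of \<open>c\<close> tells
  which case occurred: none if \<open>b\<close> had only the child \<open>c\<close> and no sibling,
  one if \<open>b\<close> had another child, two if it had another child and a sibling.\<close>

fun attach_sibling :: "inctree \<Rightarrow> inctree" where
  "attach_sibling (Tip a) = Tip a"
| "attach_sibling (Unary a t) = Unary a (attach_sibling t)"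
| "attach_sibling (Binary a l r) = (if l = Tip b then
     (case r of Tip x \<Rightarrow> Unary a (Unary b (Tip c))
      | Unary x g \<Rightarrow> Unary a (Binary b (Tip c) g)
      | Binary x f g \<Rightarrow> Binary a (Binary b (Tip c) g) f)
     else Binary a (attach_sibling l) r)"

text \<open>Undoes the \<open>Inr\<close> results: \<open>b\<close> with left child \<open>c\<close>
  is placed where the left spine first exceeds \<open>b\<close>. The displaced subtree becomes the
  sibling of \<open>b\<close> below a unary vertex, and the sibling of \<open>c\<close>
  otherwise.\<close>

fun attach :: "inctree \<Rightarrow> inctree" where
  "attach (Tip a) = Binary b (Tip c) (Tip a)"
| "attach (Unary a t) = (if b < a then Binary b (Tip c) (Unary a t)
     else if b < root t then Binary a (Unary b (Tip c)) t else Unary a (attach t))"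
| "attach (Binary a l r) = (if b < a then Binary b (Tip c) (Binary a l r)
     else if b < root l then Binary a (Binary b (Tip c) l) r else Binary a (attach l) r)"

text \<open>\<open>detach\<close> looks one level ahead for \<open>b\<close>. Away from
  \<open>b\<close> it merely descends, and \<open>leaf_child t\<close> excludes \<open>Tip\<close>,
  where its value is a dummy.\<close>

lemma detach_Unary:
  "a \<noteq> b \<Longrightarrow> root t \<noteq> b \<Longrightarrow> leaf_child t \<Longrightarrow>
    detach (Unary a t) = map_sum (Unary a) (Unary a) (detach t)"
  by (cases t) (simp_all del: detach.simps(2) add: detach.simps(2)[of a])

lemma detach_Binary:
  "a \<noteq> b \<Longrightarrow> root l \<noteq> b \<Longrightarrow> leaf_child l \<Longrightarrow>
    detach (Binary a l r) = map_sum (\<lambda>l. Binary a l r) (\<lambda>l. Binary a l r) (detach l)"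
  by (cases l) (simp_all del: detach.simps(3) add: detach.simps(3)[of a])

lemma leaf_sibling_root:
  assumes "valid t" "leaf_sibling t"
  shows "root t < b"
proof -
  have "root t \<noteq> leaf t"
    using assms root_eq_leaf[of t] by (cases t) auto
  then show ?thesis
    using assms leaf_sibling_leaf root_le_leaf[of t] by auto
qed

text \<open>The root is part of the claim because the order conditions at the vertex above refer to
  it; it is unchanged since the surgery happens below it.\<close>

lemma attach_sibling:
  assumes "valid t" "leaf_sibling t"
  shows "valid (attach_sibling t) \<and> labels (attach_sibling t) = labels t \<and>
    root (attach_sibling t) = root t \<and> leaf_child (attach_sibling t) \<and>
    detach (attach_sibling t) = Inl t"
  using assms
proof (induction t)
  case (Unary a t)
  then have "root t < b"
    using leaf_sibling_root by auto
  then show ?case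
    using Unary by (auto simp: detach_Unary simp del: detach.simps)
next
  case (Binary a l r)
  show ?case
  proof (cases "l = Tip b")
    case True
    then show ?thesis
      using Binary.prems bc by (cases r) (auto simp: less_root_notin)
  next
    case False
    then have "root l < b"
      using Binary leaf_sibling_root by auto
    then show ?thesis
      using False Binary by (auto simp: detach_Binary simp del: detach.simps)
  qed
qed auto

text \<open>Since \<open>c < leaf t\<close>, the descent meets a vertex above \<open>b\<close>. The
  root changes only when \<open>b\<close> is placed on top, whence the minimum.\<close>

lemma attach:
  assumes "valid t" "c < leaf t" "\<forall>z\<in>labels t. z < b \<or> c < z"
  shows "valid (attach t) \<and> labels (attach t) = insert b (insert c (labels t)) \<and>
    root (attach t) = min b (root t) \<and> leaf_child (attach t) \<and>
    detach (attach t) = Inr t"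
  using assms
proof (induction t)
  case (Tip a)
  then show ?case using bc by auto
next
  case (Unary a t)
  consider "b < a" | "a < b" "b < root t" | "a < b" "root t < b"
    using Unary.prems bc by (metis insertCI labels.simps(2) less_trans root_in_labels)
  then show ?case
  proof cases
    case 1
    with Unary.prems show ?thesis
      using bc less_root_notin[of b t] less_root_notin[of c t] by auto
  next
    case 2
    with Unary.prems show ?thesis
      using bc less_root_notin[of b t] by auto
  next
    case 3
    with Unary show ?thesis
      using bc by (auto simp: detach_Unary simp del: detach.simps)
  qed
next
  case (Binary a l r)
  consider "b < a" | "a < b" "b < root l" | "a < b" "root l < b"
    using Binary.prems bc by (metis UnCI insertCI labels.simps(3) less_trans root_in_labels)
  then show ?case
  proof cases
    case 1
    with Binary.prems show ?thesis
      using bc less_root_notin[of c l] less_root_notin[of c r] less_root_notin[of b l]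
        less_root_notin[of b r] by auto
  next
    case 2
    \<comment> \<open>\<open>c\<close> and \<open>l\<close> become siblings, so the order of their
      roots matters.\<close>
    moreover have "c < root l"
      using 2 Binary.prems by (metis UnCI insertCI labels.simps(3) not_less_iff_gr_or_eq root_in_labels)
    ultimately show ?thesis
      using Binary.prems bc less_root_notin[of c l] less_root_notin[of c r] less_root_notin[of b l]
        less_root_notin[of b r] by auto
  next
    case 3
    have "\<forall>z\<in>labels r. z < b \<or> c < z"
      using Binary.prems by auto
    then have "b \<notin> labels r" "c \<notin> labels r"
      using bc by auto
    with 3 Binary show ?thesis
      using bc by (auto simp: detach_Binary simp del: detach.simps)
  qed
qed

lemma leaf_child_root:
  "valid t \<Longrightarrow> leaf_child t \<Longrightarrow> root t \<le> b"
  by (induction t) auto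

lemma leaf_child_labels:
  "leaf_child t \<Longrightarrow> b \<in> labels t \<and> c \<in> labels t"
  by (induction t) auto

text \<open>Labels below the root exceed \<open>b\<close>, so the search along the left spine must
  succeed at the root itself.\<close>

lemma leaf_child_root_eq:
  assumes "valid t" "leaf_child t" "root t = b"
  obtains "t = Unary b (Tip c)" | g where "t = Binary b (Tip c) g"
  using assms leaf_child_root by (cases t) force+

lemma attach_greater: "b < root t \<Longrightarrow> attach t = Binary b (Tip c) t"
  by (cases t) auto

text \<open>The converse of \<open>attach_sibling\<close>. In the excluded tree
  \<open>Unary b (Tip c)\<close> the vertex \<open>b\<close> has no parent and no second child, so
  there is nothing to rearrange.\<close>

lemma detach_Inl:
  assumes "valid t" "leaf_child t" "detach t = Inl s" "t \<noteq> Unary b (Tip c)"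
    "\<forall>z\<in>labels t. z \<le> b \<or> c \<le> z"
  shows "valid s \<and> labels s = labels t \<and> root s = root t \<and> leaf_sibling s \<and> attach_sibling s = t"
  using assms
proof (induction t arbitrary: s)
  case (Unary a t)
  then have ab: "a \<noteq> b" "a < b" "leaf_child t" "valid t"
    using leaf_child_root[of t] by auto
  show ?case
  proof (cases "root t = b")
    case True
    from leaf_child_root_eq[OF ab(4,3) this] show ?thesis
      using Unary.prems ab bc by cases (auto simp: less_root_notin)
  next
    case False
    then have "detach (Unary a t) = map_sum (Unary a) (Unary a) (detach t)" "t \<noteq> Unary b (Tip c)"
      using ab by (auto intro!: detach_Unary simp del: detach.simps)
    moreover from this obtain s' where "detach t = Inl s'" "s = Unary a s'"
      using Unary.prems by (cases "detach t") auto
    ultimately show ?thesis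
      using Unary.IH[of s'] Unary.prems ab by simp
  qed
next
  case (Binary a l r)
  show ?case
  proof (cases "a = b")
    case True
    then show ?thesis using Binary.prems by auto
  next
    case ab: False
    then have lc: "leaf_child l" "valid l"
      using Binary.prems by auto
    then have "b \<in> labels l" "c \<in> labels l"
      using leaf_child_labels by auto
    then have r: "b \<notin> labels r" "c \<notin> labels r"
      using Binary.prems by auto
    show ?thesis
    proof (cases "root l = b")
      case True
      \<comment> \<open>\<open>r\<close> stands to the right of the subtree rooted at
        \<open>b\<close>, so its root exceeds \<open>b\<close>; no label lies between
        \<open>b\<close> and \<open>c\<close>, and \<open>c\<close> itself is in
        \<open>l\<close>.\<close>
      have "c < root r"
        using True Binary.prems r by (metis UnCI labels.simps(3) insertCI le_eq_less_or_eq not_le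
            root_in_labels valid.simps(3))
      from leaf_child_root_eq[OF lc(2,1) True] show ?thesis
      proof cases
        case 1
        then show ?thesis using Binary.prems ab bc by auto
      next
        case (2 g)
        with lc(2) bc have "b \<notin> labels g" "c \<notin> labels g"
          using less_root_notin[of b g] by auto
        with 2 show ?thesis
          using Binary.prems ab bc r \<open>c < root r\<close> by (auto split: if_splits)
      qed
    next
      case False
      then have "detach (Binary a l r) = map_sum (\<lambda>l. Binary a l r) (\<lambda>l. Binary a l r) (detach l)" "l \<noteq> Unary b (Tip c)"
        using ab lc by (auto intro!: detach_Binary simp del: detach.simps)
      moreover from this obtain s' where "detach l = Inl s'" "s = Binary a s' r"
        using Binary.prems by (cases "detach l") auto
      \<comment> \<open>\<open>leaf_sibling s'\<close> fails for tips; hence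
        \<open>attach_sibling\<close> descends into \<open>s'\<close> instead of acting at
        \<open>a\<close>.\<close>
      moreover have "s' \<noteq> Tip b"
        using Binary.IH(1)[of s'] Binary.prems calculation lc by auto
      ultimately show ?thesis
        using Binary.IH(1)[of s'] Binary.prems lc by simp
    qed
  qed
qed auto

text \<open>Without \<open>b\<close> and \<open>c\<close> the left spine continues into a sibling of
  one of them, whose labels all exceed \<open>c\<close>. The root survives unless it is
  \<open>b\<close>; this clause keeps the order conditions at the vertex above intact.\<close>

lemma detach_Inr:
  assumes "valid t" "leaf_child t" "detach t = Inr s" "t \<noteq> Unary b (Tip c)"
    "\<forall>z\<in>labels t. z \<le> b \<or> c \<le> z"
  shows "valid s \<and> labels s = labels t - {b, c} \<and> c < leaf s \<and> attach s = t \<and>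
     (root t \<noteq> b \<longrightarrow> root s = root t)"
  using assms
proof (induction t arbitrary: s)
  case (Unary a t)
  then have ab: "a \<noteq> b" "a < b" "leaf_child t" "valid t"
    using leaf_child_root[of t] by auto
  show ?case
  proof (cases "root t = b")
    case True
    from leaf_child_root_eq[OF ab(4,3) this] show ?thesis
      using Unary.prems ab bc by cases (auto simp: less_root_notin)
  next
    case False
    then have "detach (Unary a t) = map_sum (Unary a) (Unary a) (detach t)" "t \<noteq> Unary b (Tip c)"
      using ab by (auto intro!: detach_Unary simp del: detach.simps)
    moreover from this obtain s' where "detach t = Inr s'" "s = Unary a s'"
      using Unary.prems by (cases "detach t") auto
    moreover have "root t < b" 
      using False ab leaf_child_root[of t] by auto
    ultimately show ?thesis
      using Unary.IH[of s'] Unary.prems ab bc by auto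
  qed
next
  case (Binary a l r)
  show ?case
  proof (cases "a = b")
    case True
    then have "l = Tip c"
      using Binary.prems leaf_child_root[of l] by auto
    moreover have "b \<notin> labels r" "c \<notin> labels r" "c < root r"
      using Binary.prems True calculation bc less_root_notin[of b r] by auto
    moreover from this have "c < leaf r" "attach r = Binary b (Tip c) r"
      using Binary.prems root_le_leaf[of r] bc attach_greater by (simp_all del: attach.simps)
    ultimately show ?thesis using Binary.prems True by auto
  next
    case ab: False
    then have lc: "leaf_child l" "valid l" "a < b" "root l \<le> b"
      using Binary.prems leaf_child_root[of l] by auto
    have "b \<in> labels l" "c \<in> labels l"
      using lc leaf_child_labels by auto
    then have r: "b \<notin> labels r" "c \<notin> labels r"
      using Binary.prems by auto
    show ?thesis
    proof (cases "root l = b")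
      case True
      have "c < root r" using True r Binary.prems
        by (metis UnCI insertCI labels.simps(3) le_eq_less_or_eq not_le root_in_labels valid.simps(3))
      have "c < leaf r"
        using \<open>c < root r\<close> Binary.prems root_le_leaf[of r] by auto
      from leaf_child_root_eq[OF lc(2,1) True] show ?thesis
      proof cases
        case 1
        then show ?thesis
          using Binary.prems ab bc r lc \<open>c < root r\<close> \<open>c < leaf r\<close> by auto
      next
        case (2 g)
        with lc(2) bc have "b \<notin> labels g" "c \<notin> labels g" "c < leaf g"
          using less_root_notin[of b g] root_le_leaf[of g] by auto
        moreover have "root g \<noteq> root r"
          using 2 Binary.prems by (metis IntI UnCI empty_iff insertCI labels.simps(3) root_in_labels valid.simps(3))
        ultimately show ?thesis
          using 2 Binary.prems ab bc r lc \<open>c < root r\<close> by (auto split: if_splits)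
      qed
    next
      case False
      then have "detach (Binary a l r) = map_sum (\<lambda>l. Binary a l r) (\<lambda>l. Binary a l r) (detach l)" "l \<noteq> Unary b (Tip c)"
        using ab lc by (auto intro!: detach_Binary simp del: detach.simps)
      moreover from this obtain s' where "detach l = Inr s'" "s = Binary a s' r"
        using Binary.prems by (cases "detach l") auto
      moreover have "root l < b" 
        using False lc by auto
      ultimately show ?thesis
        using Binary.IH(1)[of s'] Binary.prems lc r bc by auto
    qed
  qed
qed auto

lemma bij_betw_detach:
  assumes "finite S" "b \<in> S" "c \<in> S" "S \<noteq> {b, c}" "\<forall>z\<in>S. z \<le> b \<or> c \<le> z"
  shows "bij_betw detach {t \<in> inctrees S. leaf_child t}
    ({t \<in> inctrees S. leaf_sibling t} <+> {t \<in> inctrees (S - {b, c}). c < leaf t})"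
proof (rule bij_betw_byWitness[where f' = "case_sum attach_sibling attach"])
  let ?X = "{t \<in> inctrees S. leaf_child t}"
  let ?Y = "{t \<in> inctrees S. leaf_sibling t}"
  let ?Z = "{t \<in> inctrees (S - {b, c}). c < leaf t}"
  have X: "case_sum attach_sibling attach (detach t) = t \<and> detach t \<in> ?Y <+> ?Z" if "t \<in> ?X" for t
  proof -
    \<comment> \<open>This is where \<open>S \<noteq> {b, c}\<close> enters: the one tree excluded
      from the surgery has just these two labels.\<close>
    have "t \<noteq> Unary b (Tip c)"
      using that assms by (auto simp: inctrees_def)
    show ?thesis
    proof (cases "detach t")
      case (Inl s)
      then show ?thesis
        using that assms detach_Inl[OF _ _ Inl \<open>t \<noteq> Unary b (Tip c)\<close>]
        by (simp add: inctrees_def InlI)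
    next
      case (Inr s)
      then show ?thesis
        using that assms detach_Inr[OF _ _ Inr \<open>t \<noteq> Unary b (Tip c)\<close>]
        by (simp add: inctrees_def InrI)
    qed
  qed
  have Y: "attach_sibling t \<in> ?X \<and> detach (attach_sibling t) = Inl t" if "t \<in> ?Y" for t
    using that attach_sibling[of t] by (simp add: inctrees_def)
  have Z: "attach t \<in> ?X \<and> detach (attach t) = Inr t" if "t \<in> ?Z" for t
  proof -
    have "\<forall>z\<in>labels t. z < b \<or> c < z"
      using that assms(5) by (force simp: inctrees_def)
    moreover have "insert b (insert c (S - {b, c})) = S"
      using assms(2,3) by auto
    ultimately show ?thesis
      using that attach[of t] by (simp add: inctrees_def)
  qed
  show "\<forall>t\<in>?X. case_sum attach_sibling attach (detach t) = t" "detach ` ?X \<subseteq> ?Y <+> ?Z"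
    using X by blast+
  show "\<forall>x\<in>?Y <+> ?Z. detach (case_sum attach_sibling attach x) = x"
    "case_sum attach_sibling attach ` (?Y <+> ?Z) \<subseteq> ?X"
    using Y Z by (auto simp del: attach.simps attach_sibling.simps detach.simps)
qed

end

section \<open>The graph of a tree\<close>

fun edges :: "inctree \<Rightarrow> nat set set" where
  "edges (Tip a) = {}"
| "edges (Unary a t) = insert {a, root t} (edges t)"
| "edges (Binary a l r) = insert {a, root l} (insert {a, root r} (edges l \<union> edges r))"

lemma edges_subset:
  "valid t \<Longrightarrow> e \<in> edges t \<Longrightarrow> \<exists>i\<in>labels t. \<exists>j\<in>labels t. e = {i, j} \<and> i < j"
proof (induction t)
  case (Unary a t)
  show ?case
  proof (cases "e \<in> edges t")
    case True
    then show ?thesis using Unary by auto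
  next
    case False
    then show ?thesis
      using Unary.prems by (intro bexI[of _ a] bexI[of _ "root t"]) auto
  qed
next
  case (Binary a l r)
  consider "e \<in> edges l" | "e \<in> edges r" | "e = {a, root l}" | "e = {a, root r}"
    using Binary.prems by auto
  then show ?case
  proof cases
    case 1
    then show ?thesis using Binary by auto
  next
    case 2
    then show ?thesis using Binary by auto
  next
    case 3
    then show ?thesis
      using Binary.prems by (intro bexI[of _ a] bexI[of _ "root l"]) auto
  next
    case 4
    then show ?thesis
      using Binary.prems by (intro bexI[of _ a] bexI[of _ "root r"]) auto
  qed
qed auto

text \<open>Describes the position of \<open>t\<close> in a larger graph \<open>E\<close>, so that it passes to subtrees.\<close>

fun spans :: "nat set set \<Rightarrow> inctree \<Rightarrow> bool" where
  "spans E (Tip a) \<longleftrightarrow> children E a = {}"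
| "spans E (Unary a t) \<longleftrightarrow> children E a = {root t} \<and> spans E t"
| "spans E (Binary a l r) \<longleftrightarrow> children E a = {root l, root r} \<and> spans E l \<and> spans E r"

lemma spans_cong:
  "(\<And>v. v \<in> labels t \<Longrightarrow> children E v = children E' v) \<Longrightarrow> spans E t = spans E' t"
  by (induction t) auto

text \<open>At a binary vertex the set of children determines left and right, because validity puts
  the smaller root on the left.\<close>

lemma spans_unique:
  "valid s \<Longrightarrow> valid t \<Longrightarrow> spans E s \<Longrightarrow> spans E t \<Longrightarrow> root s = root t \<Longrightarrow> s = t"
proof (induction s arbitrary: t)
  case (Tip a)
  then show ?case by (cases t) auto
next
  case (Unary a s)
  from Unary.prems(3-5) Unary.prems(2) obtain s' where t: "t = Unary a s'" "root s = root s'"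
    by (cases t) auto
  with Unary.IH[of s'] Unary.prems show ?case by simp
next
  case (Binary a l r)
  from Binary.prems(3-5) Binary.prems(1) obtain l' r'
    where t: "t = Binary a l' r'" "{root l, root r} = {root l', root r'}"
    by (cases t) auto
  then have "root l = root l'" "root r = root r'"
    using Binary.prems by (auto simp: doubleton_eq_iff)
  with t Binary.IH(1)[of l'] Binary.IH(2)[of r'] Binary.prems show ?case by simp
qed

lemma children_notin:
  assumes "valid t" "v \<notin> labels t"
  shows "children (edges t) v = {}"
  using edges_subset[OF assms(1)] assms(2) by (fastforce simp: children_def doubleton_eq_iff)

lemma children_Un: "children (E \<union> F) v = children E v \<union> children F v"
  by (auto simp: children_def)

lemma children_insert:
  "i < j \<Longrightarrow> children (insert {i, j} E) v = (if v = i then insert j (children E v) else children E v)"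
  by (auto simp: children_def doubleton_eq_iff)

text \<open>The labels of the subtrees are disjoint and do not contain the root, so a vertex of a
  subtree gains no children in the whole graph.\<close>

lemma spans_edges: "valid t \<Longrightarrow> spans (edges t) t"
proof (induction t)
  case (Unary a t)
  then have "a \<notin> labels t"
    by (simp add: less_root_notin)
  moreover have "spans (edges (Unary a t)) t \<longleftrightarrow> spans (edges t) t"
    using calculation Unary by (intro spans_cong) (auto simp: children_insert)
  ultimately show ?case
    using Unary by (simp add: children_insert children_notin)
next
  case (Binary a l r)
  then have a: "a \<notin> labels l" "a \<notin> labels r"
    by (auto simp: less_root_notin)
  moreover have "spans (edges (Binary a l r)) l \<longleftrightarrow> spans (edges l) l"
    using a Binary by (intro spans_cong) (auto simp: children_insert children_Un children_notin disjoint_iff)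
  moreover have "v \<notin> labels l" if "v \<in> labels r" for v
    using Binary.prems that by auto
  then have "spans (edges (Binary a l r)) r \<longleftrightarrow> spans (edges r) r"
    using a Binary.prems by (intro spans_cong) (auto simp: children_insert children_Un children_notin)
  ultimately show ?case
    using Binary by (simp add: children_insert children_Un children_notin)
qed (simp add: children_def)

lemma root_eq_Min: "valid t \<Longrightarrow> root t = Min (labels t)"
  by (rule sym, rule Min_eqI) (auto simp: root_le)

text \<open>Both terms fit into the same graph, and their roots agree as the least element of
  \<open>S\<close>.\<close>

lemma inj_on_edges: "inj_on edges (inctrees S)"
proof (rule inj_onI)
  fix s t assume *: "s \<in> inctrees S" "t \<in> inctrees S" "edges s = edges t"
  then have "spans (edges t) s"
    using spans_edges[of s] by (simp add: inctrees_def)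
  with * show "s = t"
    using spans_unique spans_edges root_eq_Min by (simp add: inctrees_def)
qed

text \<open>\<open>edges\<close> embeds the terms into the finite collection of sets of subsets of
  \<open>S\<close>.\<close>

lemma finite_inctrees: "finite S \<Longrightarrow> finite (inctrees S)"
proof (rule inj_on_finite[OF inj_on_edges])
  show "edges ` inctrees S \<subseteq> Pow (Pow S)"
  proof clarsimp
    fix t e x assume "t \<in> inctrees S" "e \<in> edges t" "x \<in> e"
    then show "x \<in> S"
      using edges_subset[of t e] by (auto simp: inctrees_def)
  qed
qed simp

section \<open>The common recursion\<close>

text \<open>Trees with leaf \<open>c\<close> are split by \<open>leaf_child\<close>, those with leaf
  \<open>b\<close> by \<open>leaf_sibling\<close>. The exchange matches the parts where these fail,
  and \<open>detach\<close> accounts for the others and for the extra summand.\<close>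

lemma (in label_pair) card_inctrees_step:
  assumes "finite S" "b \<in> S" "c \<in> S" "S \<noteq> {b, c}" "\<forall>z\<in>S. z \<le> b \<or> c \<le> z"
  shows "card {t \<in> inctrees S. leaf t = c} =
    card {t \<in> inctrees S. leaf t = b} + card {t \<in> inctrees (S - {b, c}). c < leaf t}"
proof -
  note fin = finite_inctrees[OF assms(1)] finite_inctrees[OF finite_Diff[OF assms(1)]]
  have "{t \<in> inctrees S. leaf t = c} = {t \<in> inctrees S. leaf_child t} \<union>
      {t \<in> inctrees S. leaf t = c \<and> \<not> leaf_child t}"
    using leaf_child_leaf by auto
  then have "card {t \<in> inctrees S. leaf t = c} = card {t \<in> inctrees S. leaf_child t} +
      card {t \<in> inctrees S. leaf t = c \<and> \<not> leaf_child t}"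
    using fin by (auto intro: card_Un_disjoint)
  also have "card {t \<in> inctrees S. leaf_child t} = card {t \<in> inctrees S. leaf_sibling t} +
      card {t \<in> inctrees (S - {b, c}). c < leaf t}"
    using bij_betw_same_card[OF bij_betw_detach[OF assms]] fin by (simp add: card_Plus)
  also have "card {t \<in> inctrees S. leaf t = c \<and> \<not> leaf_child t} =
      card {t \<in> inctrees S. leaf t = b \<and> \<not> leaf_sibling t}"
    using assms by (intro card_transpose_trees) auto
  also have "card {t \<in> inctrees S. leaf_sibling t} + card {t \<in> inctrees (S - {b, c}). c < leaf t} +
      card {t \<in> inctrees S. leaf t = b \<and> \<not> leaf_sibling t} =
      card ({t \<in> inctrees S. leaf_sibling t} \<union> {t \<in> inctrees S. leaf t = b \<and> \<not> leaf_sibling t}) +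
      card {t \<in> inctrees (S - {b, c}). c < leaf t}"
    using fin by (subst card_Un_disjoint) auto
  also have "{t \<in> inctrees S. leaf_sibling t} \<union> {t \<in> inctrees S. leaf t = b \<and> \<not> leaf_sibling t} =
      {t \<in> inctrees S. leaf t = b}"
    using leaf_sibling_leaf by auto
  finally show ?thesis .
qed

section \<open>Down-up words and their recursion\<close>

fun alternating :: "bool \<Rightarrow> nat list \<Rightarrow> bool" where
  "alternating down (x # y # zs) \<longleftrightarrow> (if down then x > y else x < y) \<and> alternating (\<not> down) (y # zs)"
| "alternating down _ \<longleftrightarrow> True"

definition down_up_words :: "nat set \<Rightarrow> nat list set" where
  "down_up_words S = {w. distinct w \<and> set w = S \<and> alternating True w}"

lemma finite_down_up_words: "finite S \<Longrightarrow> finite (down_up_words S)"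
  by (rule finite_subset[OF _ finite_subset_distinct[of S]]) (auto simp: down_up_words_def)

lemma down_up_words_singleton: "down_up_words {k} = {[k]}"
proof (intro equalityI subsetI)
  fix w assume w: "w \<in> down_up_words {k}"
  then have "length w = Suc 0"
    using distinct_card[of w] by (simp add: down_up_words_def)
  then obtain x where "w = [x]"
    by (auto simp: length_Suc_conv)
  with w show "w \<in> {[k]}"
    by (simp add: down_up_words_def)
qed (simp add: down_up_words_def)

lemma inctrees_singleton: "inctrees {k} = {Tip k}"
proof (intro equalityI subsetI)
  fix t assume t: "t \<in> inctrees {k}"
  then have "root t = k" "leaf t = k" "valid t"
    using root_in_labels[of t] leaf_in_labels[of t] by (simp_all add: inctrees_def)
  then show "t \<in> {Tip k}"
    using root_eq_leaf[of t] by simp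
qed (simp add: inctrees_def)

lemma inctree_doubleton:
  assumes t: "valid t" "labels t = {b, k}" and b: "b < k"
  shows "t = Unary b (Tip k)"
proof (cases t)
  case (Tip a)
  then show ?thesis using t b by auto
next
  case (Unary a s)
  then have "a \<in> {b, k}" "root s \<in> {b, k}" "leaf s \<in> {b, k}"
    by (simp_all flip: t(2))
  moreover have "a < root s" "root s \<le> leaf s" "valid s"
    using t(1) Unary root_le_leaf[of s] by simp_all
  ultimately have "a = b" "root s = k" "leaf s = k"
    using b by (simp_all; linarith)+
  then show ?thesis
    using Unary root_eq_leaf[OF \<open>valid s\<close>] by simp
next
  case (Binary a l r)
  then have "a \<in> {b, k}" "root l \<in> {b, k}" "root r \<in> {b, k}"
    by (simp_all flip: t(2))
  then show ?thesis
    using t(1) Binary by auto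
qed

lemma alternating_map:
  "strict_mono_on (set w) f \<Longrightarrow> alternating d w \<Longrightarrow> alternating d (map f w)"
proof (induction d w rule: alternating.induct)
  case (1 d x y zs)
  then have "strict_mono_on (set (y # zs)) f"
    by (auto simp: strict_mono_on_def)
  moreover have "x < y \<Longrightarrow> f x < f y" "y < x \<Longrightarrow> f y < f x"
    using 1(2) by (auto simp: strict_mono_on_def)
  ultimately show ?case
    using 1 by (auto split: if_splits)
qed auto

text \<open>List indices start at 0, so a word beginning with a descent goes down at the even
  ones.\<close>

lemma alternating_nth:
  "alternating d w \<longleftrightarrow>
    (\<forall>i<length w - 1. if even i = d then w ! i > w ! Suc i else w ! i < w ! Suc i)"
proof (induction d w rule: alternating.induct)
  case (1 d x y zs)
  then show ?case
    by (auto simp: All_less_Suc2)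
qed auto

context label_pair
begin

text \<open>The first letter is \<open>b\<close> or \<open>c\<close>, so the remaining letters
  contain only the other one and keep their relative order. The second letter is smaller than the
  first and different from \<open>b\<close>, hence below both, and the initial descent
  survives.\<close>

lemma card_transpose_words:
  assumes "b \<in> S" "c \<in> S" "\<forall>z\<in>S. z \<le> b \<or> c \<le> z" "S \<noteq> {b, c}"
  shows "card {w \<in> down_up_words S. hd w = c \<and> w ! 1 \<noteq> b} = card {w \<in> down_up_words S. hd w = b}"
proof (rule bij_betw_same_card)
  let ?f = "map (transpose b c)"
  have img: "transpose b c ` S = S"
    using assms by (simp add: transpose_image_eq)
  have *: "alternating True (?f w) \<and> ?f w ! 1 = w ! 1"
    if w: "w \<in> down_up_words S" "hd w \<in> {b, c}" "w ! 1 \<noteq> b" "w ! 1 \<noteq> c" for w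
  proof -
    \<comment> \<open>\<open>remdups_adj.cases\<close> serves to split lists by length 0, 1 and at
      least 2; the two labels \<open>b\<close>, \<open>c\<close> leave only the last case.\<close>
    obtain x y zs where xy: "w = x # y # zs"
      using w assms(1,2) bc by (cases w rule: remdups_adj.cases) (auto simp: down_up_words_def)
    have "strict_mono_on (set (y # zs)) (transpose b c)"
      using w assms(3) xy by (intro transpose_strict_mono_on) (auto simp: down_up_words_def)
    moreover have "alternating False (y # zs)" "y < x"
      using w xy by (auto simp: down_up_words_def)
    ultimately have "alternating False (?f (y # zs))"
      using alternating_map by blast
    moreover have "y < transpose b c x"
      using w assms(3) xy \<open>y < x\<close> bc by (auto simp: down_up_words_def)
    ultimately show ?thesis
      using w xy by simp
  qed
  have **: "w ! 1 \<noteq> hd w" "w ! 1 < hd w" "w \<noteq> []" if "w \<in> down_up_words S" for w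
    using that assms(1,2) bc
    by (cases w rule: remdups_adj.cases; auto simp: down_up_words_def)+
  show "bij_betw ?f {w \<in> down_up_words S. hd w = c \<and> w ! 1 \<noteq> b} {w \<in> down_up_words S. hd w = b}"
  proof (rule bij_betw_byWitness[where f' = ?f])
    show "?f ` {w \<in> down_up_words S. hd w = c \<and> w ! 1 \<noteq> b} \<subseteq> {w \<in> down_up_words S. hd w = b}"
    proof (rule image_subsetI)
      fix w assume "w \<in> {w \<in> down_up_words S. hd w = c \<and> w ! 1 \<noteq> b}"
      then show "?f w \<in> {w \<in> down_up_words S. hd w = b}"
        using *[of w] **[of w] img by (auto simp: down_up_words_def distinct_map hd_map)
    qed
    show "?f ` {w \<in> down_up_words S. hd w = b} \<subseteq> {w \<in> down_up_words S. hd w = c \<and> w ! 1 \<noteq> b}"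
    proof (rule image_subsetI)
      fix w assume "w \<in> {w \<in> down_up_words S. hd w = b}"
      then show "?f w \<in> {w \<in> down_up_words S. hd w = c \<and> w ! 1 \<noteq> b}"
        using *[of w] **[of w] img bc by (auto simp: down_up_words_def distinct_map hd_map)
    qed
  qed (auto simp: comp_def)
qed

text \<open>What remains are the words starting with \<open>c b\<close>. Their third letter is above
  \<open>b\<close>, and as \<open>c\<close> is used up and no label lies in between, this means
  above \<open>c\<close>. Dropping two letters preserves the parity of positions.\<close>

lemma card_words_step:
  assumes "finite S" "b \<in> S" "c \<in> S" "S \<noteq> {b, c}" "\<forall>z\<in>S. z \<le> b \<or> c \<le> z"
  shows "card {w \<in> down_up_words S. hd w = c} =
    card {w \<in> down_up_words S. hd w = b} + card {w \<in> down_up_words (S - {b, c}). c < hd w}"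
proof -
  note fin = finite_down_up_words[OF assms(1)]
  have "bij_betw (\<lambda>w. c # b # w) {w \<in> down_up_words (S - {b, c}). c < hd w}
      {w \<in> down_up_words S. hd w = c \<and> w ! 1 = b}"
  proof (rule bij_betw_imageI)
    show "(\<lambda>w. c # b # w) ` {w \<in> down_up_words (S - {b, c}). c < hd w} =
      {w \<in> down_up_words S. hd w = c \<and> w ! 1 = b}" (is "?g ` ?X = ?Y")
    proof
      show "?g ` ?X \<subseteq> ?Y"
      proof (rule image_subsetI)
        fix w assume "w \<in> ?X"
        then show "?g w \<in> ?Y"
          using assms bc by (cases w) (auto simp: down_up_words_def)
      qed
      show "?Y \<subseteq> ?g ` ?X"
      proof
        fix w assume w: "w \<in> ?Y"
        then obtain u where u: "w = c # b # u"
          using assms bc by (cases w rule: remdups_adj.cases) (auto simp: down_up_words_def)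
        moreover have "set u = S - {b, c}"
          using w u by (auto simp: down_up_words_def)
        \<comment> \<open>\<open>S \<noteq> {b, c}\<close> guarantees a third letter, so
          \<open>hd u\<close> is meaningful.\<close>
        moreover have "u \<noteq> []"
          using w u assms by (auto simp: down_up_words_def)
        moreover from this have "hd u \<in> S" "b < hd u" "hd u \<noteq> c"
          using w u by (cases u; auto simp: down_up_words_def)+
        then have "c < hd u"
          using assms(5) by force
        ultimately show "w \<in> ?g ` ?X"
          using w by (cases u) (auto simp: down_up_words_def)
      qed
    qed
  qed (auto simp: inj_on_def)
  from bij_betw_same_card[OF this]
  have "card {w \<in> down_up_words S. hd w = b} + card {w \<in> down_up_words (S - {b, c}). c < hd w} =
     card {w \<in> down_up_words S. hd w = c \<and> w ! 1 \<noteq> b} + card {w \<in> down_up_words S. hd w = c \<and> w ! 1 = b}"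
    using card_transpose_words assms by simp
  also have "\<dots> = card ({w \<in> down_up_words S. hd w = c \<and> w ! 1 \<noteq> b} \<union> {w \<in> down_up_words S. hd w = c \<and> w ! 1 = b})"
    using fin by (intro card_Un_disjoint[symmetric]) auto
  also have "{w \<in> down_up_words S. hd w = c \<and> w ! 1 \<noteq> b} \<union> {w \<in> down_up_words S. hd w = c \<and> w ! 1 = b} =
     {w \<in> down_up_words S. hd w = c}"
    by auto
  finally show ?thesis ..
qed

end

section \<open>Equality of the two counts\<close>

lemma card_greater_eq_sum:
  fixes c :: nat
  assumes "finite A" "finite S" "f ` A \<subseteq> S"
  shows "card {x \<in> A. c < f x} = (\<Sum>p | p \<in> S \<and> c < p. card {x \<in> A. f x = p})"
proof -
  have "{x \<in> A. c < f x} = (\<Union>p\<in>{p \<in> S. c < p}. {x \<in> A. f x = p})"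
    using assms by auto
  then show ?thesis
    using assms by (simp add: card_UN_disjoint disjoint_iff)
qed

text \<open>Outer induction on the size of \<open>S\<close>, inner induction on \<open>k\<close>:
  the recursion passes from \<open>k\<close> to its predecessor in \<open>S\<close> and to a set
  with two labels fewer. The empty set is excluded because the empty word has no counterpart among
  trees.\<close>

lemma card_words_eq_card_inctrees:
  assumes "finite S" "S \<noteq> {}"
  shows "card {w \<in> down_up_words S. hd w = k} = card {t \<in> inctrees S. leaf t = k}"
  using assms
proof (induction "card S" arbitrary: S k rule: less_induct)
  case less
  note outer = less.hyps and fin = less.prems(1)
  have mem: "hd w \<in> T" if "w \<in> down_up_words T" "T \<noteq> {}" for w T
    using that by (cases w) (auto simp: down_up_words_def)
  have mem': "leaf t \<in> T" if "t \<in> inctrees T" for t T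
    using that leaf_in_labels by (auto simp: inctrees_def)
  show ?case
  proof (cases "k \<in> S")
    case False
    then have "{w \<in> down_up_words S. hd w = k} = {}" "{t \<in> inctrees S. leaf t = k} = {}"
      using mem mem' less.prems by auto
    then show ?thesis by (simp only: card.empty)
  next
    case True
    then show ?thesis
    proof (induction k rule: less_induct)
      case (less k)
      consider "S = {k}" | "S \<noteq> {k}" "\<forall>z\<in>S. k \<le> z" | z where "z \<in> S" "z < k"
        by force
      then show ?case
      proof cases
        case 1
        have "{w \<in> {[k]}. hd w = k} = {[k]}" "{t \<in> {Tip k}. leaf t = k} = {Tip k}"
          by auto
        with 1 show ?thesis
          by (simp add: down_up_words_singleton inctrees_singleton)
      next
        case 2
        \<comment> \<open>Nothing is counted at the least label: a word with at least two letters
          starts with a descent, and a leaf equal to the root makes the tree a single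
          vertex.\<close>
        have "hd w \<noteq> k" if "w \<in> down_up_words S" for w
          using that 2 less.prems by (cases w rule: remdups_adj.cases) (auto simp: down_up_words_def)
        moreover have "leaf t \<noteq> k" if "t \<in> inctrees S" for t
        proof
          assume "leaf t = k"
          then have "t = Tip k"
            using that 2 root_eq_leaf[of t] root_le_leaf[of t] root_in_labels[of t]
            by (fastforce simp: inctrees_def)
          then show False
            using that 2 by (auto simp: inctrees_def)
        qed
        ultimately have "{w \<in> down_up_words S. hd w = k} = {}" "{t \<in> inctrees S. leaf t = k} = {}"
          by auto
        then show ?thesis by (simp only: card.empty)
      next
        case 3
        \<comment> \<open>The predecessor of \<open>k\<close> in \<open>S\<close>, which makes
          \<open>b\<close> and \<open>k\<close> consecutive.\<close>
        define b where "b = Max {z \<in> S. z < k}"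
        have b: "b \<in> {z \<in> S. z < k}"
          unfolding b_def using fin 3 by (intro Max_in) auto
        then interpret label_pair b k
          by unfold_locales auto
        have adj: "\<forall>z\<in>S. z \<le> b \<or> k \<le> z"
          unfolding b_def using fin by (auto simp: not_le)
        show ?thesis
        proof (cases "S = {b, k}")
          case True
          \<comment> \<open>The recursion does not cover two labels, so the single word and the
            single tree are exhibited.\<close>
          have "{w \<in> down_up_words S. hd w = k} = {[k, b]}"
          proof -
            have "w = [k, b]" if "distinct w" "set w = {b, k}" "hd w = k" for w
            proof -
              have "length w = 2"
                using that b distinct_card[of w] by auto
              then obtain x y where "w = [x, y]"
                by (auto simp: numeral_2_eq_2 length_Suc_conv)
              with that show ?thesis by auto
            qed
            then show ?thesis
              using True b by (auto simp: down_up_words_def)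
          qed
          moreover have "{t \<in> inctrees S. leaf t = k} = {Unary b (Tip k)}"
          proof (intro equalityI subsetI)
            fix t assume "t \<in> {t \<in> inctrees S. leaf t = k}"
            then show "t \<in> {Unary b (Tip k)}"
              using inctree_doubleton[of t] True b by (simp add: inctrees_def)
          qed (use True b in \<open>auto simp: inctrees_def\<close>)
          ultimately show ?thesis by simp
        next
          case False
          let ?S = "S - {b, k}"
          have "?S \<noteq> {}"
            using False b less.prems by blast
          moreover have "card ?S < card S"
            using b fin by (intro psubset_card_mono) auto
          \<comment> \<open>Splitting both counts by the value above \<open>k\<close> reduces this
            to the outer hypothesis for each such value.\<close>
          ultimately have "card {w \<in> down_up_words ?S. k < hd w} = card {t \<in> inctrees ?S. k < leaf t}"
            using fin mem[of _ ?S] mem'[of _ ?S] outer[of ?S]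
            by (simp add: card_greater_eq_sum[of _ ?S] image_subset_iff finite_down_up_words finite_inctrees)
          then show ?thesis
            using card_words_step[of S] card_inctrees_step[of S] less.IH[of b] False adj fin less.prems b
            by simp
        qed
      qed
    qed
  qed
qed

section \<open>Increasing trees as graphs\<close>

text \<open>Walks, unlike paths, compose, so connectivity is handled by the closure of this
  relation. Restricting it to \<open>V\<close> allows walks to be confined to small labels.\<close>

definition adjacency :: "'a set \<Rightarrow> 'a set set \<Rightarrow> ('a \<times> 'a) set" where
  "adjacency V E = {(x, y). x \<in> V \<and> y \<in> V \<and> {x, y} \<in> E}"

lemma sym_adjacency_rtrancl: "sym ((adjacency V E)\<^sup>*)"
  by (rule sym_rtrancl) (auto simp: adjacency_def sym_def insert_commute)

text \<open>A path is grown along the walk; whenever the next vertex already lies on it, the path is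
  cut off there.\<close>

lemma adjacency_imp_graph_path:
  assumes "(u, v) \<in> (adjacency V E)\<^sup>*" "u \<in> V"
  shows "\<exists>p. graph_path V E p \<and> hd p = u \<and> last p = v"
  using assms(1)
proof induction
  case base
  show ?case
    using assms(2) by (intro exI[of _ "[u]"]) (simp add: graph_path_def)
next
  case (step y z)
  then obtain p where p: "graph_path V E p" "hd p = u" "last p = y"
    by blast
  show ?case
  proof (cases "z \<in> set p")
    case True
    then obtain xs ys where xy: "p = (xs @ [z]) @ ys"
      by (auto simp: in_set_conv_decomp)
    then have "successively (\<lambda>u v. {u, v} \<in> E) (xs @ [z])"
      using p(1) successively_append_iff[of _ "xs @ [z]" ys] unfolding graph_path_def by blast
    then have "graph_path V E (xs @ [z])"
      using p(1) xy by (auto simp: graph_path_def)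
    moreover have "hd (xs @ [z]) = u"
      using p(2) xy by (cases xs) auto
    ultimately show ?thesis
      by (intro exI[of _ "xs @ [z]"]) simp
  next
    case False
    with p step(2) show ?thesis
      by (intro exI[of _ "p @ [z]"])
        (auto simp: graph_path_def successively_append_iff adjacency_def)
  qed
qed

lemma graph_path_imp_adjacency:
  "graph_path V E p \<Longrightarrow> (hd p, last p) \<in> (adjacency V E)\<^sup>*"
proof (induction p)
  case (Cons x p)
  show ?case
  proof (cases p)
    case Nil
    then show ?thesis by simp
  next
    case (Cons y q)
    with Cons.prems have "(x, y) \<in> adjacency V E" "graph_path V E p"
      by (auto simp: graph_path_def adjacency_def)
    with Cons.IH Cons show ?thesis
      by (auto intro: converse_rtrancl_into_rtrancl)
  qed
qed (simp add: graph_path_def)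

lemma sorted_path_le_last: "sorted_wrt (<) p \<Longrightarrow> x \<in> set p \<Longrightarrow> x \<le> last p" for p :: "nat list"
  by (induction p) (auto, metis last_in_set less_imp_le)

text \<open>The increasing path from 1 to \<open>v\<close> supplies a parent. Two parents would both
  be connected to 1 through labels below \<open>v\<close>, hence to each other, and \<open>v\<close>
  would close a cycle.\<close>

lemma unique_parent:
  assumes "increasing_tree n E" "v \<in> {2..n}"
  shows "\<exists>!u. u < v \<and> {u, v} \<in> E"
proof -
  have tree: "is_tree {1..n} E"
    and inc: "\<And>p. graph_path {1..n} E p \<Longrightarrow> hd p = 1 \<Longrightarrow> sorted_wrt (<) p"
    using assms(1) by (auto simp: increasing_tree_def)
  have path: "\<exists>p. graph_path {1..n} E p \<and> hd p = 1 \<and> last p = w" if "w \<in> {1..n}" for w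
    using tree that unfolding is_tree_def by auto
  show ?thesis
  proof (rule ex_ex1I)
    obtain p where p: "graph_path {1..n} E p" "hd p = 1" "last p = v"
      using path[of v] assms(2) by auto
    then obtain q where q: "p = q @ [v]"
      by (metis append_butlast_last_id graph_path_def)
    then have "q \<noteq> []"
      using p assms(2) by auto
    then have "last q < v \<and> {last q, v} \<in> E"
      using p q inc[of p] by (auto simp: graph_path_def successively_append_iff sorted_wrt_append)
    then show "\<exists>u. u < v \<and> {u, v} \<in> E" ..
  next
    fix u u' assume u: "u < v \<and> {u, v} \<in> E" "u' < v \<and> {u', v} \<in> E"
    let ?W = "{1..<v}"
    have walk: "(1, w) \<in> (adjacency ?W E)\<^sup>*" "w \<in> ?W" if "w < v" "{w, v} \<in> E" for w
    proof -
      have "w \<in> {1..n}"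
        using tree that unfolding is_tree_def by (fastforce simp: doubleton_eq_iff)
      then obtain p where p: "graph_path {1..n} E p" "hd p = 1" "last p = w"
        using path by blast
      \<comment> \<open>The last vertex \<open>w\<close> of an increasing path is its largest, and
        it is below \<open>v\<close>.\<close>
      moreover have "set p \<subseteq> ?W"
        using p sorted_path_le_last[OF inc[of p]] that by (fastforce simp: graph_path_def)
      ultimately show "(1, w) \<in> (adjacency ?W E)\<^sup>*"
        using graph_path_imp_adjacency[of ?W E p] by (auto simp: graph_path_def)
      show "w \<in> ?W"
        using \<open>w \<in> {1..n}\<close> that by auto
    qed
    show "u = u'"
    proof (rule ccontr)
      assume "u \<noteq> u'"
      have "(u, u') \<in> (adjacency ?W E)\<^sup>*"
        using walk u sym_adjacency_rtrancl by (meson rtrancl_trans symD)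
      from adjacency_imp_graph_path[OF this walk(2)] u
      obtain q where q: "graph_path ?W E q" "hd q = u" "last q = u'"
        by blast
      then have "length q \<ge> 2"
        using \<open>u \<noteq> u'\<close> by (cases q rule: remdups_adj.cases) (auto simp: graph_path_def)
      then have "graph_cycle {1..n} E (q @ [v])"
        using q u assms(2) by (auto simp: graph_cycle_def graph_path_def successively_append_iff hd_append insert_commute)
      then show False
        using tree by (auto simp: is_tree_def)
    qed
  qed
qed

text \<open>Going from parent to parent connects every vertex to 1. On a cycle the largest vertex
  would have two parents. A path from 1 starts upwards, and its first descent would return to the
  parent it came from.\<close>

lemma increasing_treeI:
  assumes "n \<ge> 1" and E: "E \<subseteq> {{u, v} |u v. u \<in> {1..n} \<and> v \<in> {1..n} \<and> u \<noteq> v}"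
    and parent: "\<And>v. v \<in> {2..n} \<Longrightarrow> \<exists>!u. u < v \<and> {u, v} \<in> E"
  shows "increasing_tree n E"
proof -
  let ?V = "{1..n}"
  have neq: "u \<noteq> v" and inV: "u \<in> ?V" "v \<in> ?V" if "{u, v} \<in> E" for u v
    using that E by (fastforce simp: doubleton_eq_iff)+
  have uniq: "u = u'" if "{u, v} \<in> E" "{u', v} \<in> E" "u < v" "u' < v" for u u' v
  proof -
    have "v \<in> {2..n}"
      using inV[OF that(1)] that by auto
    from parent[OF this] that show ?thesis by blast
  qed
  have walk: "(1, v) \<in> (adjacency ?V E)\<^sup>*" if "v \<in> ?V" for v
    using that
  proof (induction v rule: less_induct)
    case (less v)
    show ?case
    proof (cases "v = 1")
      case False
      then obtain u where "u < v" "{u, v} \<in> E"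
        using parent[of v] less.prems by auto
      moreover from this have "(u, v) \<in> adjacency ?V E"
        using inV[of u v] by (auto simp: adjacency_def)
      ultimately show ?thesis
        using less.IH[of u] inV[of u v] by (meson rtrancl.rtrancl_into_rtrancl)
    qed simp
  qed
  have "\<exists>p. graph_path ?V E p \<and> hd p = u \<and> last p = v" if "u \<in> ?V" "v \<in> ?V" for u v
    using walk that sym_adjacency_rtrancl adjacency_imp_graph_path
    by (meson rtrancl_trans symD)
  moreover have "\<not> graph_cycle ?V E p" for p
  proof
    assume p: "graph_cycle ?V E p"
    define m where "m = Max (set p)"
    have "p \<noteq> []"
      using p by (simp add: graph_cycle_def graph_path_def)
    then have m: "m \<in> set p" "\<forall>x\<in>set p. x \<le> m"
      by (auto simp: m_def)
    then obtain xs ys where xy: "p = xs @ m # ys"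
      by (auto simp: in_set_conv_decomp)
    \<comment> \<open>\<open>ys @ xs\<close> is the cycle opened at \<open>m\<close>; its two ends
      are the neighbours of \<open>m\<close>.\<close>
    then have len: "length (ys @ xs) \<ge> 2" and dist: "distinct (ys @ xs)" "m \<notin> set (ys @ xs)"
      using p by (auto simp: graph_cycle_def graph_path_def)
    have "xs \<noteq> []" if "ys = []"
      using len that by auto
    then have "{hd (ys @ xs), m} \<in> E"
      using p xy by (cases ys)
        (auto simp: graph_cycle_def graph_path_def successively_append_iff hd_append insert_commute)
    moreover have "xs = [] \<Longrightarrow> ys \<noteq> []"
      using len by auto
    then have "{last (ys @ xs), m} \<in> E"
      using p xy by (cases xs rule: rev_cases)
        (auto simp: graph_cycle_def graph_path_def successively_append_iff hd_append insert_commute)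
    moreover have in': "hd (ys @ xs) \<in> set (ys @ xs)" "last (ys @ xs) \<in> set (ys @ xs)"
      using len by (intro hd_in_set last_in_set; auto)+
    then have "hd (ys @ xs) < m" "last (ys @ xs) < m"
      using m(2) dist(2) xy by (metis UnCI le_neq_implies_less list.set_intros(2) set_append Un_iff)+
    ultimately have "hd (ys @ xs) = last (ys @ xs)"
      using uniq by blast
    then show False
      using len dist(1) nth_eq_iff_index_eq[OF dist(1), of 0 "length (ys @ xs) - 1"]
      by (subst (asm) hd_conv_nth, force) (subst (asm) last_conv_nth, force+)
  qed
  moreover have "sorted_wrt (<) p" if p: "graph_path ?V E p" "hd p = 1" for p
  proof -
    have edge: "{p ! i, p ! Suc i} \<in> E" if "Suc i < length p" for i
      using p that by (auto simp: graph_path_def successively_conv_nth)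
    have "p ! i < p ! Suc i" if "Suc i < length p" for i
      using that
    proof (induction i)
      case 0
      have "p ! 0 = 1"
        using p by (simp add: graph_path_def hd_conv_nth)
      then show ?case
        using edge[OF 0] neq[OF edge[OF 0]] inV[OF edge[OF 0]] by auto
    next
      case (Suc i)
      show ?case
      proof (rule ccontr)
        assume "\<not> ?case"
        then have "p ! Suc (Suc i) < p ! Suc i"
          using neq[OF edge[OF Suc.prems]] by auto
        then have "p ! i = p ! Suc (Suc i)"
          using Suc edge[of i] edge[OF Suc.prems] by (intro uniq[of _ "p ! Suc i"]) (auto simp: insert_commute)
        then show False
          using p(1) Suc.prems by (simp add: graph_path_def nth_eq_iff_index_eq)
      qed
    qed
    then show ?thesis
      by (simp add: sorted_wrt_iff_nth_Suc_transp)
  qed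
  ultimately show ?thesis
    using assms(1,2) unfolding increasing_tree_def is_tree_def by auto
qed

section \<open>Graphs of terms are binary increasing trees\<close>

lemma children_edgesD:
  assumes "valid t" "v \<in> children (edges t) u"
  shows "u \<in> labels t" "v \<in> labels t" "u < v"
  using assms edges_subset[of t "{u, v}"] by (auto simp: children_def doubleton_eq_iff)

lemma ex_parent:
  "valid t \<Longrightarrow> v \<in> labels t \<Longrightarrow> v \<noteq> root t \<Longrightarrow> \<exists>u. v \<in> children (edges t) u"
proof (induction t)
  case (Unary a t)
  then show ?case
    by (cases "v = root t") (auto simp: children_insert)
next
  case (Binary a l r)
  then show ?case
    by (cases "v = root l"; cases "v = root r") (auto simp: children_insert children_Un, metis+)
qed auto

lemma root_notin_children: "valid t \<Longrightarrow> root t \<notin> children (edges t) u"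
  using children_edgesD[of t "root t" u] root_le[of t u] by auto

lemma parent_unique:
  "valid t \<Longrightarrow> v \<in> children (edges t) u \<Longrightarrow> v \<in> children (edges t) u' \<Longrightarrow> u = u'"
proof (induction t)
  case (Unary a t)
  then show ?case
    by (auto simp: children_insert root_notin_children split: if_splits)
next
  case (Binary a l r)
  have "root l \<notin> children (edges r) x" "root r \<notin> children (edges l) x"
    "v \<in> children (edges l) x \<Longrightarrow> v \<notin> children (edges r) y" for x y
    using Binary.prems(1) children_edgesD(2)[of l] children_edgesD(2)[of r]
      root_in_labels[of l] root_in_labels[of r] unfolding valid.simps by blast+
  with Binary show ?case
    by (auto simp: children_insert children_Un root_notin_children split: if_splits)
qed (simp add: children_def)

lemma card_children_le: "spans E t \<Longrightarrow> v \<in> labels t \<Longrightarrow> card (children E v) \<le> 2"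
  by (induction t) (auto simp: card_insert_if)

text \<open>Validity puts the smaller child on the left, so the left spine follows the minimal
  children.\<close>

lemma minimal_path_spans:
  assumes "valid t" "spans E t"
  shows "\<exists>a. a \<noteq> [] \<and> hd a = root t \<and> last a = leaf t \<and> children E (leaf t) = {} \<and>
    successively (\<lambda>x y. children E x \<noteq> {} \<and> y = Min (children E x)) a"
  using assms
proof (induction t)
  case (Tip a)
  then show ?case by (intro exI[of _ "[a]"]) auto
next
  case (Unary a t)
  then obtain p where "p \<noteq> []" "hd p = root t" "last p = leaf t" "children E (leaf t) = {}"
    "successively (\<lambda>x y. children E x \<noteq> {} \<and> y = Min (children E x)) p"
    by auto
  with Unary.prems show ?case
    by (intro exI[of _ "a # p"]) (auto simp: successively_Cons)
next
  case (Binary a l r)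
  then obtain p where "p \<noteq> []" "hd p = root l" "last p = leaf l" "children E (leaf l) = {}"
    "successively (\<lambda>x y. children E x \<noteq> {} \<and> y = Min (children E x)) p"
    by auto
  with Binary.prems show ?case
    by (intro exI[of _ "a # p"]) (auto simp: successively_Cons min_def)
qed

lemma edges_in_binary_trees:
  assumes "n \<ge> 1" "t \<in> inctrees {1..n}"
  shows "edges t \<in> binary_trees n"
proof -
  have t: "valid t" "labels t = {1..n}"
    using assms(2) by (auto simp: inctrees_def)
  then have "root t = 1"
    using assms(1) by (simp add: root_eq_Min Min_eq_iff)
  have "increasing_tree n (edges t)"
  proof (rule increasing_treeI[OF assms(1)])
    show "edges t \<subseteq> {{u, v} |u v. u \<in> {1..n} \<and> v \<in> {1..n} \<and> u \<noteq> v}"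
      using edges_subset[OF t(1)] t(2) by (fastforce simp del: atLeastAtMost_iff)
    fix v assume "v \<in> {2..n}"
    then have "v \<in> labels t" "v \<noteq> root t"
      using t(2) \<open>root t = 1\<close> by auto
    then have "\<exists>!u. v \<in> children (edges t) u"
      using ex_parent[OF t(1)] parent_unique[OF t(1)] by blast
    then show "\<exists>!u. u < v \<and> {u, v} \<in> edges t"
      by (simp add: children_def conj_commute)
  qed
  then show ?thesis
    using card_children_le[OF spans_edges[OF t(1)]] t(2) by (simp add: binary_trees_def)
qed

lemma Leaf_edges:
  assumes "n \<ge> 1" "t \<in> inctrees {1..n}"
  shows "Leaf (edges t) = leaf t"
proof -
  have t: "valid t" "labels t = {1..n}"
    using assms(2) by (auto simp: inctrees_def)
  then have "root t = 1"
    using assms(1) by (simp add: root_eq_Min Min_eq_iff)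
  with minimal_path_spans[OF t(1) spans_edges[OF t(1)]] obtain a
    where "minimal_path (edges t) a" "last a = leaf t"
    by (auto simp: minimal_path_def)
  then show ?thesis
    using the1_equality[OF ex1_minimal_path[OF edges_in_binary_trees[OF assms]]]
    by (simp add: Leaf_def)
qed

section \<open>Every binary increasing tree is the graph of a term\<close>

lemma spans_children:
  "spans E t \<Longrightarrow> spans E' t \<Longrightarrow> v \<in> labels t \<Longrightarrow> children E v = children E' v"
  by (induction t) auto

text \<open>Children have larger labels, so the term can be built by induction on
  \<open>n - v\<close>. Unique parents make the descendant sets of two children disjoint, as
  validity demands.\<close>

lemma ex_inctree_spanning:
  assumes "increasing_tree n E" "\<forall>v\<in>{1..n}. card (children E v) \<le> 2" "v \<in> {1..n}"
  shows "\<exists>t. valid t \<and> spans E t \<and> root t = v \<and>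
    labels t = {w. (v, w) \<in> {(i, j). j \<in> children E i}\<^sup>*}"
  using assms(3)
proof (induction "n - v" arbitrary: v rule: less_induct)
  case less
  let ?C = "{(i, j). j \<in> children E i}"
  let ?desc = "\<lambda>v. {w. (v, w) \<in> ?C\<^sup>*}"
  have ch: "j \<in> {v<..n}" if "j \<in> children E v" for j v
    using that assms(1)
    by (fastforce simp: children_def increasing_tree_def is_tree_def doubleton_eq_iff)
  have fin: "finite (children E v)"
    using ch by (meson finite_greaterThanAtMost finite_subset subsetI)
  have IH: "\<exists>t. valid t \<and> spans E t \<and> root t = j \<and> labels t = ?desc j"
    if "j \<in> children E v" for j
    using ch[OF that] less.prems by (intro less.hyps) auto
  have parent: "i = i'" if "j \<in> children E i" "j \<in> children E i'" for i i' j
  proof -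
    have "{i, j} \<in> E" "i < j"
      using that(1) by (auto simp: children_def)
    then have "j \<in> {2..n}"
      using assms(1) by (fastforce simp: increasing_tree_def is_tree_def doubleton_eq_iff)
    from unique_parent[OF assms(1) this] that show ?thesis
      by (auto simp: children_def)
  qed
  have desc: "?desc v = insert v (\<Union>j\<in>children E v. ?desc j)"
    by (auto elim: converse_rtranclE intro: converse_rtrancl_into_rtrancl)
  have le: "v \<le> w" if "(v, w) \<in> ?C\<^sup>*" for v w
    using that by induction (auto dest!: ch)
  \<comment> \<open>Two ancestors of one vertex are comparable: parents are unique, so nontrivial
    walks to it end with the same edge.\<close>
  have chain: "(i, w) \<in> ?C\<^sup>* \<Longrightarrow> (j, w) \<in> ?C\<^sup>* \<Longrightarrow> (i, j) \<in> ?C\<^sup>* \<or> (j, i) \<in> ?C\<^sup>*" for i j w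
  proof (induction rule: rtrancl_induct)
    case (step y z)
    from step.prems show ?case
    proof (cases rule: rtranclE)
      case base
      then show ?thesis
        using step.hyps by (meson rtrancl.rtrancl_into_rtrancl)
    next
      case (step y')
      then have "y' = y"
        using parent[of z] \<open>(y, z) \<in> ?C\<close> by auto
      then show ?thesis
        using step.IH step(1) by simp
    qed
  qed simp
  \<comment> \<open>A walk from \<open>i\<close> to \<open>j\<close> would enter \<open>j\<close>
    through its parent \<open>v\<close>, although \<open>v < i\<close>.\<close>
  have no_path: "(i, j) \<notin> ?C\<^sup>*" if "i \<in> children E v" "j \<in> children E v" "i \<noteq> j" for i j
  proof
    assume "(i, j) \<in> ?C\<^sup>*"
    then show False
    proof (cases rule: rtranclE)
      case (step y)
      then have "y = v"
        using parent[of j] that by auto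
      then show False
        using le[OF step(1)] ch[OF that(1)] by simp
    qed (use that in simp)
  qed
  have disjoint: "?desc i \<inter> ?desc j = {}" if "i \<in> children E v" "j \<in> children E v" "i \<noteq> j" for i j
    using chain no_path[OF that] no_path[OF that(2,1)] that(3) by blast
  have "card (children E v) \<in> {0, 1, 2}"
    using assms(2) less.prems by fastforce
  then consider "children E v = {}" | i where "children E v = {i}"
    | i j where "children E v = {i, j}" "i < j"
    using fin by (auto simp: card_1_singleton_iff card_2_iff)
      (metis insert_commute linorder_neqE_nat)
  then show ?case
  proof cases
    case 1
    then show ?thesis
      using desc by (intro exI[of _ "Tip v"]) auto
  next
    case 2
    then obtain t where "valid t" "spans E t" "root t = i" "labels t = ?desc i"
      using IH by auto
    then show ?thesis
      using desc 2 ch[of i v] by (intro exI[of _ "Unary v t"]) auto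
  next
    case 3
    then obtain l r where "valid l" "spans E l" "root l = i" "labels l = ?desc i"
      "valid r" "spans E r" "root r = j" "labels r = ?desc j"
      using IH[of i] IH[of j] by auto
    then show ?thesis
      using desc 3 ch[of i v] ch[of j v] disjoint[of i j] by (intro exI[of _ "Binary v l r"]) auto
  qed
qed

text \<open>For surjectivity a term is grown from vertex 1. Parents lead from every vertex back to
  1, so its labels are all of \<open>{1..n}\<close>; then graph and term have the same children
  everywhere, hence the same edges.\<close>

lemma bij_betw_edges:
  assumes "n \<ge> 1"
  shows "bij_betw edges (inctrees {1..n}) (binary_trees n)"
  unfolding bij_betw_def
proof (intro conjI equalityI subsetI)
  show "inj_on edges (inctrees {1..n})"
    by (rule inj_on_edges)
next
  fix E assume "E \<in> edges ` inctrees {1..n}"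
  then show "E \<in> binary_trees n"
    using edges_in_binary_trees[OF assms] by auto
next
  fix E assume "E \<in> binary_trees n"
  then have E: "increasing_tree n E" "\<forall>v\<in>{1..n}. card (children E v) \<le> 2"
    by (auto simp: binary_trees_def)
  let ?C = "{(i, j). j \<in> children E i}"
  have range: "i \<in> {1..n}" "j \<in> {1..n}" if "{i, j} \<in> E" for i j
    using E(1) that by (fastforce simp: increasing_tree_def is_tree_def doubleton_eq_iff)+
  obtain t where t: "valid t" "spans E t" "labels t = {w. (1, w) \<in> ?C\<^sup>*}"
    using ex_inctree_spanning[OF E, of 1] assms by auto
  have "w \<in> {1..n}" if "(1, w) \<in> ?C\<^sup>*" for w
    using that assms by induction (auto simp: children_def dest: range)
  moreover have "(1, w) \<in> ?C\<^sup>*" if "w \<in> {1..n}" for w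
    using that
  proof (induction w rule: less_induct)
    case (less w)
    show ?case
    proof (cases "w = 1")
      case False
      then obtain u where u: "u < w" "{u, w} \<in> E"
        using unique_parent[OF E(1), of w] less.prems by auto
      then have "(1, u) \<in> ?C\<^sup>*"
        using less.IH[of u] range[of u w] by blast
      moreover have "(u, w) \<in> ?C"
        using u by (simp add: children_def)
      ultimately show ?thesis
        by (rule rtrancl_into_rtrancl)
    qed simp
  qed
  ultimately have labels: "labels t = {1..n}"
    unfolding t(3) by (intro set_eqI iffI) (unfold mem_Collect_eq)
  have ch: "children E v = children (edges t) v" if "v \<in> {1..n}" for v
    using spans_children[OF t(2) spans_edges[OF t(1)]] that labels by simp
  have "E = edges t"
  proof (intro equalityI subsetI)
    fix e assume "e \<in> E"
    then obtain u v where "e = {u, v}" "u < v" "u \<in> {1..n}"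
      using E(1) unfolding increasing_tree_def is_tree_def
      by (fastforce dest!: subsetD elim!: linorder_neqE_nat)
    then show "e \<in> edges t"
      using ch[of u] \<open>e \<in> E\<close> by (auto simp: children_def)
  next
    fix e assume e: "e \<in> edges t"
    then obtain u v where "e = {u, v}" "u < v" "u \<in> {1..n}"
      using edges_subset[OF t(1) e] labels by auto
    then show "e \<in> E"
      using ch[of u] e by (auto simp: children_def)
  qed
  then show "E \<in> edges ` inctrees {1..n}"
    using t(1) labels by (auto simp: inctrees_def)
qed

section \<open>Gluing bijections between fibres\<close>

lemma bij_betw_words:
  "bij_betw (\<lambda>p. map p [1..<Suc n]) (down_up n) (down_up_words {1..n})"
  unfolding bij_betw_def
proof (intro conjI equalityI subsetI)
  show "inj_on (\<lambda>p. map p [1..<Suc n]) (down_up n)"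
  proof (rule inj_onI, rule ext)
    fix p q x assume *: "p \<in> down_up n" "q \<in> down_up n" "map p [1..<Suc n] = map q [1..<Suc n]"
    show "p x = q x"
    proof (cases "x \<in> {1..n}")
      case True
      then have "x \<in> set [1..<Suc n]"
        by auto
      with *(3) show ?thesis
        unfolding map_eq_conv by blast
    next
      case False
      with * show ?thesis
        using permutes_not_in[OF _ False] unfolding down_up_def by (metis (no_types, lifting) mem_Collect_eq)
    qed
  qed
next
  \<comment> \<open>List index \<open>i\<close> holds the letter at position \<open>i + 1\<close>,
    so descents at even indices become descents at odd positions.\<close>
  have alt: "alternating True (map p [1..<Suc n]) \<longleftrightarrow>
      (\<forall>i\<in>{1..<n}. if odd i then p i > p (Suc i) else p i < p (Suc i))" for p
  proof -
    have "alternating True (map p [1..<Suc n]) \<longleftrightarrow>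
      (\<forall>i<n - 1. if odd (Suc i) then p (Suc i) > p (Suc (Suc i)) else p (Suc i) < p (Suc (Suc i)))"
      unfolding alternating_nth by (auto simp: nth_append simp del: upt_Suc)
    also have "\<dots> \<longleftrightarrow> (\<forall>i\<in>Suc ` {..<n - 1}. if odd i then p i > p (Suc i) else p i < p (Suc i))"
      by auto
    also have "Suc ` {..<n - 1} = {1..<n}"
      by (cases n) (auto simp: image_Suc_lessThan)
    finally show ?thesis .
  qed
  {
    fix w assume "w \<in> (\<lambda>p. map p [1..<Suc n]) ` down_up n"
    then obtain p where p: "p \<in> down_up n" "w = map p [1..<Suc n]"
      by blast
    then have perm: "p permutes {1..n}"
      by (simp add: down_up_def)
    show "w \<in> down_up_words {1..n}"
      unfolding down_up_words_def p(2)
      using p(1) alt[of p] permutes_image[OF perm] permutes_inj_on[OF perm]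
      by (simp add: down_up_def distinct_map atLeastLessThanSuc_atLeastAtMost del: upt_Suc)
  next
    fix w assume "w \<in> down_up_words {1..n}"
    then have w: "distinct w" "set w = {1..n}" "alternating True w"
      by (auto simp: down_up_words_def)
    then have len: "length w = n"
      using distinct_card by fastforce
    define p where "p i = (if i \<in> {1..n} then w ! (i - 1) else i)" for i
    have map: "map p [1..<Suc n] = w"
      by (rule nth_equalityI) (auto simp: len p_def simp del: upt_Suc)
    have "p permutes {1..n}"
    proof (rule bij_imp_permutes)
      have "distinct (map p [1..<Suc n])" "set (map p [1..<Suc n]) = {1..n}"
        using map w by simp_all
      moreover have "set [1..<Suc n] = {1..n}"
        by auto
      ultimately show "bij_betw p {1..n} {1..n}"
        by (simp add: bij_betw_def distinct_map del: upt_Suc)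
    qed (auto simp: p_def)
    then have "p \<in> down_up n"
      using alt[of p] map w(3) by (simp add: down_up_def)
    with map show "w \<in> (\<lambda>p. map p [1..<Suc n]) ` down_up n"
      by blast
  }
qed

text \<open>Equal cardinalities give a bijection between the fibres over each \<open>k\<close>;
  \<open>h (f x) x\<close> applies the one belonging to the value of \<open>x\<close>, and the
  fibres partition \<open>X\<close> and \<open>Y\<close>.\<close>

lemma bij_betw_fibres:
  assumes "finite X" "finite Y" "\<And>k. card {x \<in> X. f x = k} = card {y \<in> Y. g y = k}"
  shows "\<exists>h. bij_betw h X Y \<and> (\<forall>x\<in>X. g (h x) = f x)"
proof -
  have "\<exists>h. bij_betw h {x \<in> X. f x = k} {y \<in> Y. g y = k}" for k
    using assms by (intro finite_same_card_bij) auto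
  then obtain h where h: "\<And>k. bij_betw (h k) {x \<in> X. f x = k} {y \<in> Y. g y = k}"
    by metis
  have mem: "h (f x) x \<in> Y" "g (h (f x) x) = f x" if "x \<in> X" for x
    using bij_betwE[OF h[of "f x"]] that by auto
  have "bij_betw (\<lambda>x. h (f x) x) X Y"
    unfolding bij_betw_def
  proof
    show "inj_on (\<lambda>x. h (f x) x) X"
    proof (rule inj_onI)
      fix x y assume *: "x \<in> X" "y \<in> X" "h (f x) x = h (f y) y"
      then have "f x = f y"
        using mem(2) by metis
      with * show "x = y"
        using inj_onD[OF bij_betw_imp_inj_on[OF h[of "f x"]], of x y] by simp
    qed
    show "(\<lambda>x. h (f x) x) ` X = Y"
    proof (intro equalityI subsetI)
      fix y assume "y \<in> Y"
      then obtain x where "x \<in> X" "f x = g y" "y = h (g y) x"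
        using bij_betw_imp_surj_on[OF h[of "g y"]] by blast
      then show "y \<in> (\<lambda>x. h (f x) x) ` X"
        by (intro image_eqI[of _ _ x]) simp_all
    qed (use mem in auto)
  qed
  with mem show ?thesis by blast
qed

theorem theorem3:
  fixes n :: nat
  assumes "n \<ge> 1"
  shows "\<exists>\<Psi> :: (nat \<Rightarrow> nat) \<Rightarrow> nat set set.
           bij_betw \<Psi> (down_up n) (binary_trees n) \<and>
           (\<forall>\<pi>\<in>down_up n. \<pi> 1 = Leaf (\<Psi> \<pi>))"
proof -
  let ?W = "\<lambda>p. map p [1..<Suc n]" and ?S = "{1..n}"
  obtain h where h: "bij_betw h (down_up_words ?S) (inctrees ?S)"
    "\<And>w. w \<in> down_up_words ?S \<Longrightarrow> leaf (h w) = hd w"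
    using bij_betw_fibres[of "down_up_words ?S" "inctrees ?S" hd leaf] assms
      card_words_eq_card_inctrees[of ?S] finite_down_up_words[of ?S] finite_inctrees[of ?S]
    by auto
  \<comment> \<open>From a permutation to its word, then to a term whose leaf is the first letter,
    then to the graph of that term.\<close>
  let ?\<Psi> = "edges \<circ> (h \<circ> ?W)"
  have "bij_betw ?\<Psi> (down_up n) (binary_trees n)"
    by (intro bij_betw_trans[OF _ bij_betw_edges[OF assms]] bij_betw_trans[OF bij_betw_words h(1)])
  moreover have "p 1 = Leaf (?\<Psi> p)" if "p \<in> down_up n" for p
  proof -
    have w: "?W p \<in> down_up_words ?S"
      using bij_betwE[OF bij_betw_words] that by blast
    then have "Leaf (?\<Psi> p) = hd (?W p)"
      using Leaf_edges[OF assms] h bij_betwE[OF h(1)] by simp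
    also have "\<dots> = p 1"
      using assms by (simp add: hd_map upt_conv_Cons del: upt_Suc)
    finally show ?thesis ..
  qed
  ultimately show ?thesis by blast
qed

end
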